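(* Let $G$ and $H$ be connected graphs. Then $$\max\{b_{\rm g}(G),b_{\rm g}(H)\} \leq b_{\rm g}(G \boxtimes H) \leq b_{\rm g}(G \,\Box\, H) \leq \min\{2b(G^2) - 1 + \mathrm{rad}(H),\; 2 b(H^2) - 1 + \mathrm{rad}(G)\}$$ and $$\max\{b_{\rm g}'(G),b_{\rm g}'(H)\} \leq b_{\rm g}'(G \boxtimes H) \leq b_{\rm g}'(G \,\Box\, H) \leq \min\{2b(G^2) + \mathrm{rad}(H),\; 2 b(H^2) + \mathrm{rad}(G)\}.$$
   Context: All graphs are finite, simple and undirected; connected graphs are nonempty. The burning game on a graph $G$ is played by two players, Burner and Staller, in rounds $t=1,2,3,\dots$. Initially (round $0$) all vertices are unburned. Each round $t\ge 1$ consists of two phases: first, in the spreading phase, every unburned vertex having a burning neighbor starts to burn (fire spreads simultaneously, by distance one, from all burning vertices); then, in the selection phase, if unburned vertices remain, the player whose turn it is chooses one unburned vertex, which starts to burn. Burning vertices stay burning forever. The players alternate: one of them selects in the odd rounds, the other in the even rounds. The game ends in the first round in which all vertices of $G$ are burning (possibly already after the spreading phase of that round). Burner wants to minimize the number of rounds and Staller wants to maximize it. If both play optimally, the number of rounds is denoted $b_{\rm g}(G)$ when Burner makes the first move (selects in round 1), and $b_{\rm g}'(G)$ when Staller makes the first move. The burning number $b(G)$ is the minimum number of rounds needed to burn all vertices of $G$ in the same process when a single agent makes all selections (one vertex per round). The square $G^2$ of $G$ has vertex set $V(G)$, with distinct $u,v$ adjacent iff $d_G(u,v)\le 2$. The radius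 $\mathrm{rad}(G)$ is the minimum over vertices $u$ of $\max_{v\in V(G)} d_G(u,v)$. The Cartesian product $G\,\Box\, H$ has vertex set $V(G)\times V(H)$, with $(u,v)$ and $(x,y)$ adjacent iff $u=x$ and $vy\in E(H)$, or $ux\in E(G)$ and $v=y$. The strong product $G\boxtimes H$ has vertex set $V(G)\times V(H)$, with $(u,v)$ and $(x,y)$ adjacent iff $u=x$ and $vy\in E(H)$, or $ux\in E(G)$ and $v=y$, or $ux\in E(G)$ and $vy\in E(H)$. *)

theory Defs
  imports "Graph_Theory.Pair_Digraph" "Graph_Theory.Digraph_Component"
begin

text \<open>
  Finite simple undirected graphs are represented by the locale \<^locale>\<open>pair_graph\<close>: finite
  loop-free symmetric digraphs without parallel arcs. An undirected edge \<open>uv\<close> corresponds to the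
  two arcs \<open>(u, v)\<close> and \<open>(v, u)\<close>. The library's notion of connectedness excludes the empty graph.
\<close>

subsection \<open>Distance, radius, square and products\<close>

text \<open>The value of \<open>graph_dist G u v\<close> is unspecified if \<open>v\<close> is not reachable from \<open>u\<close>.\<close>

definition graph_dist :: "'a pair_pre_digraph \<Rightarrow> 'a \<Rightarrow> 'a \<Rightarrow> nat" where
  "graph_dist G u v = (LEAST n. \<exists>p. pre_digraph.awalk (with_proj G) u p v \<and> length p = n)"

definition radius :: "'a pair_pre_digraph \<Rightarrow> nat" where
  "radius G = Min ((\<lambda>u. Max (graph_dist G u ` pverts G)) ` pverts G)"

definition graph_square :: "'a pair_pre_digraph \<Rightarrow> 'a pair_pre_digraph" where
  "graph_square G = \<lparr> pverts = pverts G,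
     parcs = {(u, v). u \<in> pverts G \<and> v \<in> pverts G \<and> u \<noteq> v \<and>
                u \<rightarrow>\<^sup>*\<^bsub>with_proj G\<^esub> v \<and> graph_dist G u v \<le> 2} \<rparr>"

definition cartesian_product ::
    "'a pair_pre_digraph \<Rightarrow> 'b pair_pre_digraph \<Rightarrow> ('a \<times> 'b) pair_pre_digraph" where
  "cartesian_product G H = \<lparr> pverts = pverts G \<times> pverts H,
     parcs = {((u, v), (x, y)).
                u \<in> pverts G \<and> u = x \<and> (v, y) \<in> parcs H \<or>
                (u, x) \<in> parcs G \<and> v \<in> pverts H \<and> v = y} \<rparr>"

definition strong_product ::
    "'a pair_pre_digraph \<Rightarrow> 'b pair_pre_digraph \<Rightarrow> ('a \<times> 'b) pair_pre_digraph" where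
  "strong_product G H = \<lparr> pverts = pverts G \<times> pverts H,
     parcs = {((u, v), (x, y)).
                u \<in> pverts G \<and> u = x \<and> (v, y) \<in> parcs H \<or>
                (u, x) \<in> parcs G \<and> v \<in> pverts H \<and> v = y \<or>
                (u, x) \<in> parcs G \<and> (v, y) \<in> parcs H} \<rparr>"

subsection \<open>The burning process\<close>

definition spread :: "'a pair_pre_digraph \<Rightarrow> 'a set \<Rightarrow> 'a set" where
  "spread G B = B \<union> {v \<in> pverts G. \<exists>u \<in> B. (u, v) \<in> parcs G}"

text \<open>
  \<open>round_outcomes G B\<close> is the set of all possible sets of burning vertices after a round that
  starts with the set \<open>B\<close> burning, one for each possible selection.
\<close>

definition round_outcomes :: "'a pair_pre_digraph \<Rightarrow> 'a set \<Rightarrow> 'a set set" where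
  "round_outcomes G B =
     (if pverts G \<subseteq> spread G B then {spread G B}
      else (\<lambda>v. insert v (spread G B)) ` (pverts G - spread G B))"

definition burning_number :: "'a pair_pre_digraph \<Rightarrow> nat" where
  "burning_number G =
     (LEAST k. \<exists>B :: nat \<Rightarrow> 'a set. B 0 = {} \<and>
        (\<forall>i<k. B (Suc i) \<in> round_outcomes G (B i)) \<and> pverts G \<subseteq> B k)"

subsection \<open>The burning game\<close>

datatype player = Burner | Staller

fun opponent :: "player \<Rightarrow> player" where
  "opponent Burner = Staller"
| "opponent Staller = Burner"

fun best_for :: "player \<Rightarrow> nat set \<Rightarrow> nat" where
  "best_for Burner N = Min N"
| "best_for Staller N = Max N"

lemma round_outcomes_strict:
  assumes "\<not> pverts G \<subseteq> B" and "C \<in> round_outcomes G B"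
  shows "pverts G - C \<subset> pverts G - B"
  using assms unfolding round_outcomes_def spread_def by (auto split: if_splits)

text \<open>
  \<open>remaining_rounds G p B\<close> is the minimax value of the position where \<open>B\<close> is burning between two
  rounds and \<open>p\<close> selects in the next round: the number of rounds still to be played under optimal
  play. The finiteness test only serves to make the function total.
\<close>

function remaining_rounds :: "'a pair_pre_digraph \<Rightarrow> player \<Rightarrow> 'a set \<Rightarrow> nat" where
  "remaining_rounds G p B =
     (if infinite (pverts G) \<or> pverts G \<subseteq> B then 0
      else Suc (best_for p ((\<lambda>C. remaining_rounds G (opponent p) C) ` round_outcomes G B)))"
  by pat_completeness auto
termination
  by (relation "Wellfounded.measure (\<lambda>(G, p, B). card (pverts G - B))")
     (simp_all add: psubset_card_mono round_outcomes_strict)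

declare remaining_rounds.simps [simp del]

definition game_burning_number :: "'a pair_pre_digraph \<Rightarrow> nat" where
  "game_burning_number G = remaining_rounds G Burner {}"

definition staller_game_burning_number :: "'a pair_pre_digraph \<Rightarrow> nat" where
  "staller_game_burning_number G = remaining_rounds G Staller {}"

end

theory Submission
  imports Defs
begin

text \<open>
  The lower bounds and the middle inequality come from one comparison principle: a surjective map
  that sends every edge to an edge or to a single vertex cannot make the game longer, since the
  image of a spreading fire never outruns the fire in the image. It is applied to the two projections
  of the strong product and to the identity map from the Cartesian to the strong product.

  For the upper bound, Burner takes a burning sequence of \<open>G\<^sup>2\<close> and plays its vertices in the layer
  over a center of \<open>H\<close>. Between two of his moves the fire spreads twice, which inside that layer is
  one spreading step of \<open>G\<^sup>2\<close>, so his \<open>b(G\<^sup>2)\<close>-th move completes the layer; the rest burns within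
  \<open>rad(H)\<close> further rounds. A first move of Staller delays this by at most one round.
\<close>

section \<open>Single rounds and the minimax recursion\<close>

lemma spread_superset: "B \<subseteq> spread G B"
  by (auto simp: spread_def)

lemma spread_mono: "B \<subseteq> C \<Longrightarrow> spread G B \<subseteq> spread G C"
  by (auto simp: spread_def)

lemma finite_round_outcomes: "finite (pverts G) \<Longrightarrow> finite (round_outcomes G B)"
  by (simp add: round_outcomes_def)

lemma round_outcomes_nonempty: "round_outcomes G B \<noteq> {}"
  by (auto simp: round_outcomes_def)

lemma spread_subset_round_outcome: "C \<in> round_outcomes G B \<Longrightarrow> spread G B \<subseteq> C"
  by (auto simp: round_outcomes_def split: if_splits)

text \<open>This lets a player follow a plan even when the intended vertex already burns: then every
  outcome of the round contains it.\<close>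

lemma round_outcome_covering:
  assumes "v \<in> pverts G"
  obtains C where "C \<in> round_outcomes G B" "insert v (spread G B) \<subseteq> C"
proof (cases "v \<in> spread G B")
  case True
  obtain C where "C \<in> round_outcomes G B"
    using round_outcomes_nonempty by blast
  then show ?thesis
    using that True spread_subset_round_outcome[of C G B] by blast
next
  case False
  then have "insert v (spread G B) \<in> round_outcomes G B"
    using assms by (auto simp: round_outcomes_def)
  then show ?thesis using that by blast
qed

lemma remaining_rounds_burned: "pverts G \<subseteq> B \<Longrightarrow> remaining_rounds G p B = 0"
  by (simp add: remaining_rounds.simps)

lemma remaining_rounds_Burner_le:
  assumes "finite (pverts G)" "C \<in> round_outcomes G B"
  shows "remaining_rounds G Burner B \<le> Suc (remaining_rounds G Staller C)"
  using assms by (subst remaining_rounds.simps) (auto simp: finite_round_outcomes intro!: Min_le)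

lemma remaining_rounds_Burner_optimal:
  assumes "finite (pverts G)" "\<not> pverts G \<subseteq> B"
  obtains C where "C \<in> round_outcomes G B"
    "remaining_rounds G Burner B = Suc (remaining_rounds G Staller C)"
proof -
  let ?V = "remaining_rounds G Staller ` round_outcomes G B"
  have "Min ?V \<in> ?V"
    using assms finite_round_outcomes round_outcomes_nonempty by (intro Min_in) auto
  moreover have "remaining_rounds G Burner B = Suc (Min ?V)"
    using assms by (subst remaining_rounds.simps) simp
  ultimately show ?thesis using that by auto
qed

lemma remaining_rounds_Staller_ge:
  assumes "finite (pverts G)" "\<not> pverts G \<subseteq> B" "C \<in> round_outcomes G B"
  shows "Suc (remaining_rounds G Burner C) \<le> remaining_rounds G Staller B"
  using assms
  by (subst (2) remaining_rounds.simps) (auto simp: finite_round_outcomes intro!: Max_ge)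

lemma remaining_rounds_Staller_le:
  assumes "finite (pverts G)"
    and "\<And>C. C \<in> round_outcomes G B \<Longrightarrow> remaining_rounds G Burner C \<le> n"
  shows "remaining_rounds G Staller B \<le> Suc n"
  using assms
  by (subst remaining_rounds.simps) (auto simp: finite_round_outcomes round_outcomes_nonempty)

section \<open>Comparing games along a weak homomorphism\<close>

text \<open>
  Burner transfers his play in \<open>X\<close> to \<open>Y\<close> along \<open>f\<close>; each vertex that Staller selects in \<open>Y\<close> has an
  unburned preimage in \<open>X\<close>, which serves as Staller's reply there.
\<close>

lemma remaining_rounds_weak_hom:
  assumes fin: "finite (pverts X)"
    and surj: "f ` pverts X = pverts Y"
    and hom: "\<And>u v. (u, v) \<in> parcs X \<Longrightarrow> f u = f v \<or> (f u, f v) \<in> parcs Y"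
    and sub: "f ` C \<subseteq> B"
  shows "remaining_rounds Y p B \<le> remaining_rounds X p C"
  using sub
proof (induction "card (pverts X - C)" arbitrary: p B C rule: less_induct)
  case less
  have finY: "finite (pverts Y)" using fin surj by (metis finite_imageI)
  show ?case
  proof (cases "pverts Y \<subseteq> B")
    case True
    then show ?thesis by (simp add: remaining_rounds_burned)
  next
    case nB: False
    have nC: "\<not> pverts X \<subseteq> C" using nB less.prems surj by blast
    have IH: "remaining_rounds Y q B' \<le> remaining_rounds X q C'"
      if "C' \<in> round_outcomes X C" "f ` C' \<subseteq> B'" for q B' C'
      using less.hyps that round_outcomes_strict[OF nC that(1)] fin
      by (simp add: psubset_card_mono)
    have spr: "f ` spread X C \<subseteq> spread Y B"
      using less.prems surj hom by (fastforce simp: spread_def)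
    show ?thesis
    proof (cases p)
      case Burner
      obtain C' where C': "C' \<in> round_outcomes X C"
        "remaining_rounds X Burner C = Suc (remaining_rounds X Staller C')"
        using remaining_rounds_Burner_optimal[OF fin nC] by blast
      \<comment> \<open>If spreading alone completes \<open>X\<close>, nothing is selected and
        \<open>v\<close> is a dummy; some vertex exists because \<open>C\<close> does not cover
        \<open>X\<close>.\<close>
      obtain v where v: "v \<in> pverts X" "C' \<subseteq> insert v (spread X C)"
        using C'(1) nC by (auto simp: round_outcomes_def split: if_splits)
      obtain B' where B': "B' \<in> round_outcomes Y B" "insert (f v) (spread Y B) \<subseteq> B'"
        using round_outcome_covering[of "f v" Y B] v(1) surj by blast
      have "remaining_rounds Y Burner B \<le> Suc (remaining_rounds Y Staller B')"
        using remaining_rounds_Burner_le[OF finY B'(1)] .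
      also have "\<dots> \<le> Suc (remaining_rounds X Staller C')"
        using IH[OF C'(1), of B'] v(2) B'(2) spr by fastforce
      finally show ?thesis using C'(2) Burner by simp
    next
      case Staller
      \<comment> \<open>Whatever Staller does in \<open>Y\<close>, some reply in \<open>X\<close>
        keeps the image of the fire inside the fire of \<open>Y\<close>.\<close>
      have "\<exists>C' \<in> round_outcomes X C. f ` C' \<subseteq> B'" if B': "B' \<in> round_outcomes Y B" for B'
      proof (cases "pverts X \<subseteq> spread X C")
        case True
        then show ?thesis
          using spread_subset_round_outcome[OF B'] spr by (auto simp: round_outcomes_def)
      next
        case nX: False
        show ?thesis
        proof (cases "pverts Y \<subseteq> spread Y B")
          case True
          \<comment> \<open>Here \<open>Y\<close> is finished while \<open>X\<close> is not, so any
            unburned vertex serves as Staller's reply: its image burns already.\<close>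
          obtain v where v: "v \<in> pverts X" "v \<notin> spread X C" using nX by blast
          moreover have "f v \<in> B'"
            using True v(1) surj spread_subset_round_outcome[OF B'] by blast
          ultimately show ?thesis
            using nX spr spread_subset_round_outcome[OF B']
            by (auto simp: round_outcomes_def intro!: bexI[of _ v])
        next
          case False
          then obtain y where y: "y \<in> pverts Y" "y \<notin> spread Y B" "B' = insert y (spread Y B)"
            using B' by (auto simp: round_outcomes_def)
          obtain v where v: "v \<in> pverts X" "f v = y" using y(1) surj by (metis imageE)
          moreover have "v \<notin> spread X C" using y(2) v(2) spr by blast
          ultimately show ?thesis
            using nX spr y(3) by (auto simp: round_outcomes_def intro!: bexI[of _ v])
        qed
      qed
      then have le: "Suc (remaining_rounds Y Burner B') \<le> remaining_rounds X Staller C"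
        if "B' \<in> round_outcomes Y B" for B'
        using that IH remaining_rounds_Staller_ge[OF fin nC]
        by (meson Suc_le_mono le_trans)
      \<comment> \<open>Some outcome in \<open>Y\<close> exists, so \<open>le\<close> forces the
        value in \<open>X\<close> to be positive.\<close>
      then obtain m where m: "remaining_rounds X Staller C = Suc m"
        using round_outcomes_nonempty[of Y B] by (cases "remaining_rounds X Staller C") auto
      with le have "remaining_rounds Y Staller B \<le> Suc m"
        by (intro remaining_rounds_Staller_le[OF finY]) simp
      then show ?thesis using m Staller by simp
    qed
  qed
qed

text \<open>The identity is a weak homomorphism, so extra fire never prolongs the game.\<close>

lemma remaining_rounds_antimono:
  assumes "finite (pverts G)" "B \<subseteq> C"
  shows "remaining_rounds G p C \<le> remaining_rounds G p B"
  using remaining_rounds_weak_hom[of G id G B C p] assms by simp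

text \<open>Staller's round only enlarges the fire, so Burner then moves from a position at least as
  good as \<open>B\<close>.\<close>

lemma remaining_rounds_Staller_le_Burner:
  assumes "finite (pverts G)"
  shows "remaining_rounds G Staller B \<le> Suc (remaining_rounds G Burner B)"
proof (rule remaining_rounds_Staller_le[OF assms])
  fix C assume "C \<in> round_outcomes G B"
  then have "B \<subseteq> C"
    by (rule order_trans[OF spread_superset spread_subset_round_outcome])
  then show "remaining_rounds G Burner C \<le> remaining_rounds G Burner B"
    by (rule remaining_rounds_antimono[OF assms])
qed

text \<open>Every outcome of a round contains the spread fire, so \<open>n\<close> rounds burn at
  least the \<open>n\<close>-fold spread, whatever is selected.\<close>

lemma remaining_rounds_le_spread:
  assumes "finite (pverts G)" "pverts G \<subseteq> (spread G ^^ n) B"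
  shows "remaining_rounds G p B \<le> n"
  using assms(2)
proof (induction n arbitrary: p B)
  case 0
  then show ?case by (simp add: remaining_rounds_burned)
next
  case (Suc n)
  have mono: "(spread G ^^ n) C \<subseteq> (spread G ^^ n) D" if "C \<subseteq> D" for C D
    using that by (induction n) (auto intro!: spread_mono)
  have le: "remaining_rounds G q C \<le> n" if "C \<in> round_outcomes G B" for q C
    using Suc.prems Suc.IH mono[OF spread_subset_round_outcome[OF that]]
    by (auto simp: funpow_Suc_right simp del: funpow.simps)
  obtain C where C: "C \<in> round_outcomes G B" using round_outcomes_nonempty by blast
  show ?case
  proof (cases p)
    case Burner
    then show ?thesis
      using remaining_rounds_Burner_le[OF assms(1) C] le[OF C, of Staller] by simp
  next
    case Staller
    then show ?thesis using remaining_rounds_Staller_le[OF assms(1)] le by simp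
  qed
qed

section \<open>Burning sequences of optimal length\<close>

text \<open>Arbitrary selections succeed, since the number of unburned vertices drops every round.
  This makes the \<open>LEAST\<close> in \<open>burning_number\<close> attained.\<close>

lemma burning_sequence_exists:
  assumes "finite (pverts G)"
  shows "\<exists>k B. B 0 = {} \<and> (\<forall>i<k. B (Suc i) \<in> round_outcomes G (B i)) \<and> pverts G \<subseteq> B k"
proof -
  define B where "B = rec_nat {} (\<lambda>_ A. SOME C. C \<in> round_outcomes G A)"
  have B0: "B 0 = {}" by (simp add: B_def)
  have step: "B (Suc i) \<in> round_outcomes G (B i)" for i
    using some_in_eq[of "round_outcomes G (B i)"] round_outcomes_nonempty[of G "B i"]
    by (simp add: B_def)
  have "\<exists>k. pverts G \<subseteq> B k"
  proof (rule ccontr)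
    assume "\<not> ?thesis"
    then have "(B (Suc i), B i) \<in> Wellfounded.measure (\<lambda>A. card (pverts G - A))" for i
      using round_outcomes_strict[OF _ step] assms by (auto intro!: psubset_card_mono)
    then show False using wf_measure wf_iff_no_infinite_down_chain by blast
  qed
  then show ?thesis using B0 step by blast
qed

lemma burning_number_sequence:
  assumes "finite (pverts G)"
  obtains B where "B 0 = {}" "\<And>i. i < burning_number G \<Longrightarrow> B (Suc i) \<in> round_outcomes G (B i)"
    "pverts G \<subseteq> B (burning_number G)"
  using LeastI_ex[OF burning_sequence_exists[OF assms]] that
  unfolding burning_number_def by blast

lemma burning_number_pos:
  assumes "finite (pverts G)" "pverts G \<noteq> {}"
  shows "burning_number G > 0"
  using burning_number_sequence[OF assms(1)] assms(2) by (metis gr0I subset_empty)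

section \<open>Walks, distances and centers\<close>

text \<open>Fire advances along the image of the walk by one arc per spreading. The maps used for
  \<open>f\<close> embed a factor as a layer of the Cartesian product.\<close>

lemma awalk_image_spread:
  assumes "pair_graph G" "pre_digraph.awalk (with_proj G) u p v"
    and "\<And>a b. (a, b) \<in> parcs G \<Longrightarrow> (f a, f b) \<in> parcs X"
    and "\<And>a. a \<in> pverts G \<Longrightarrow> f a \<in> pverts X"
    and "f u \<in> C"
  shows "f v \<in> (spread X ^^ length p) C"
  using assms(2,5)
proof (induction p arbitrary: u C)
  interpret pair_graph G by fact
  case Nil
  then show ?case by (simp add: awalk_Nil_iff)
next
  interpret pair_graph G by fact
  case (Cons e p)
  obtain a b where e: "e = (a, b)" by fastforce
  have w: "a = u" "(u, b) \<in> parcs G" "pre_digraph.awalk (with_proj G) b p v" "b \<in> pverts G"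
    using Cons.prems(1) e by (auto simp: awalk_Cons_iff)
  then have "f b \<in> spread X C" using assms(3,4) Cons.prems(2) by (auto simp: spread_def)
  then show ?case using Cons.IH[OF w(3)] by (simp add: funpow_Suc_right del: funpow.simps)
qed

lemma graph_dist_awalk:
  assumes "pair_graph G" "u \<rightarrow>\<^sup>*\<^bsub>with_proj G\<^esub> v"
  obtains p where "pre_digraph.awalk (with_proj G) u p v" "length p = graph_dist G u v"
proof -
  interpret pair_graph G by fact
  have "\<exists>n p. awalk u p v \<and> length p = n" using assms(2) reachable_awalk by blast
  from LeastI_ex[OF this] show ?thesis using that unfolding graph_dist_def by blast
qed

lemma funpow_spread_mono: "m \<le> n \<Longrightarrow> (spread G ^^ m) B \<subseteq> (spread G ^^ n) B"
  by (rule lift_Suc_mono_le[of "\<lambda>n. (spread G ^^ n) B"]) (auto simp: spread_superset)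

lemma radius_center:
  assumes "finite (pverts G)" "pverts G \<noteq> {}"
  obtains w where "w \<in> pverts G" "\<And>v. v \<in> pverts G \<Longrightarrow> graph_dist G w v \<le> radius G"
proof -
  have "radius G \<in> (\<lambda>u. Max (graph_dist G u ` pverts G)) ` pverts G"
    unfolding radius_def using assms by (intro Min_in) auto
  then obtain w where w: "w \<in> pverts G" "radius G = Max (graph_dist G w ` pverts G)" by blast
  then show ?thesis using that assms by (metis Max_ge finite_imageI imageI)
qed

text \<open>Symmetry turns connectedness into strong connectedness; reachability is what gives
  \<open>graph_dist\<close> its meaning.\<close>

lemma connected_reachable:
  assumes "pair_graph G" "Digraph_Component.connected (with_proj G)"
    "u \<in> pverts G" "v \<in> pverts G"
  shows "u \<rightarrow>\<^sup>*\<^bsub>with_proj G\<^esub> v"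
proof -
  interpret pair_graph G by fact
  have "strongly_connected (with_proj G)"
    using symmetric_connected_imp_strongly_connected[OF sym_arcs assms(2)] .
  then show ?thesis using assms(3,4) by (auto simp: strongly_connected_def)
qed

lemma connected_nonempty: "Digraph_Component.connected (with_proj G) \<Longrightarrow> pverts G \<noteq> {}"
  by (auto simp: Digraph_Component.connected_def strongly_connected_def)

section \<open>Burner's strategy on the Cartesian product\<close>

text \<open>An edge of the square comes from a walk of length at most 2 in \<open>G\<close>, which
  can be copied into the layer over \<open>w\<close>.\<close>

lemma cartesian_spread_square:
  assumes "pair_graph G" "w \<in> pverts H" "B \<times> {w} \<subseteq> C"
  shows "spread (graph_square G) B \<times> {w}
    \<subseteq> spread (cartesian_product G H) (spread (cartesian_product G H) C)"
proof -
  let ?X = "cartesian_product G H"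
  have "(v, w) \<in> spread ?X (spread ?X C)"
    if uv: "u \<in> B" "u \<rightarrow>\<^sup>*\<^bsub>with_proj G\<^esub> v" "graph_dist G u v \<le> 2" for u v
  proof -
    obtain p where p: "pre_digraph.awalk (with_proj G) u p v" "length p = graph_dist G u v"
      using graph_dist_awalk[OF assms(1) uv(2)] .
    have "(v, w) \<in> (spread ?X ^^ length p) C"
      using assms(2,3) uv(1)
      by (intro awalk_image_spread[OF assms(1) p(1), of "\<lambda>g. (g, w)"]) (auto simp: cartesian_product_def)
    then show ?thesis
      using funpow_spread_mono[of "length p" 2 ?X C] uv(3) p(2) by (auto simp: numeral_2_eq_2)
  qed
  moreover have "C \<subseteq> spread ?X (spread ?X C)"
    by (rule order_trans[OF spread_superset spread_superset])
  ultimately show ?thesis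
    using assms(3) unfolding spread_def[of "graph_square G"]
    by (auto simp: graph_square_def)
qed

lemma game_burning_number_cartesian_le:
  assumes G: "pair_graph G" "Digraph_Component.connected (with_proj G)"
    and H: "pair_graph H" "Digraph_Component.connected (with_proj H)"
  shows "game_burning_number (cartesian_product G H)
    \<le> 2 * burning_number (graph_square G) - 1 + radius H"
proof -
  interpret G: pair_graph G by fact
  interpret H: pair_graph H by fact
  let ?X = "cartesian_product G H" and ?k = "burning_number (graph_square G)"
  have fX: "finite (pverts ?X)" by (simp add: cartesian_product_def)
  have vG: "pverts (graph_square G) = pverts G" by (simp add: graph_square_def)
  obtain B where B: "B 0 = {}" "\<And>i. i < ?k \<Longrightarrow> B (Suc i) \<in> round_outcomes (graph_square G) (B i)"
    "pverts G \<subseteq> B ?k"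
    using burning_number_sequence[of "graph_square G"] vG by auto
  have k: "?k > 0"
    using burning_number_pos[of "graph_square G"] vG connected_nonempty[OF G(2)] by simp
  obtain w where w: "w \<in> pverts H" "\<And>v. v \<in> pverts H \<Longrightarrow> graph_dist H w v \<le> radius H"
    using radius_center[of H] connected_nonempty[OF H(2)] by auto
  \<comment> \<open>From the burning layer over the center \<open>w\<close>, fire reaches
    \<open>(g, h)\<close> along a shortest walk from \<open>w\<close> to \<open>h\<close> in the
    fibre over \<open>g\<close>.\<close>
  have base: "remaining_rounds ?X p C \<le> radius H" if C: "pverts G \<times> {w} \<subseteq> C" for p C
  proof (rule remaining_rounds_le_spread[OF fX], rule subsetI)
    fix x assume "x \<in> pverts ?X"
    then obtain g h where x: "x = (g, h)" "g \<in> pverts G" "h \<in> pverts H"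
      by (auto simp: cartesian_product_def)
    obtain p where p: "pre_digraph.awalk (with_proj H) w p h" "length p = graph_dist H w h"
      using graph_dist_awalk[OF H(1) connected_reachable[OF H w(1) x(3)]] .
    have "(g, h) \<in> (spread ?X ^^ length p) C"
      using x C by (intro awalk_image_spread[OF H(1) p(1)]) (auto simp: cartesian_product_def)
    then show "x \<in> (spread ?X ^^ radius H) C"
      using funpow_spread_mono[of "length p" "radius H" ?X C] p(2) w(2)[OF x(3)] x(1) by auto
  qed
  have burner: "\<exists>C' \<in> round_outcomes ?X C. B (Suc i) \<times> {w} \<subseteq> C'"
    if i: "i < ?k" and sub: "spread (graph_square G) (B i) \<times> {w} \<subseteq> spread ?X C" for i C
  proof -
    \<comment> \<open>If the last round of the sequence finishes by spreading alone,
      \<open>v\<close> is an arbitrary vertex of the nonempty graph \<open>G\<close>.\<close>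
    obtain v where v: "v \<in> pverts G" "B (Suc i) \<subseteq> insert v (spread (graph_square G) (B i))"
      using B(2)[OF i] connected_nonempty[OF G(2)] vG
      by (auto simp: round_outcomes_def split: if_splits)
    obtain C' where "C' \<in> round_outcomes ?X C" "insert (v, w) (spread ?X C) \<subseteq> C'"
      using round_outcome_covering[of "(v, w)" ?X C] v(1) w(1) by (auto simp: cartesian_product_def)
    then show ?thesis using v(2) sub by blast
  qed
  \<comment> \<open>\<open>j\<close> counts the steps of the burning sequence still to be imitated;
    each costs one round of Staller and one of Burner.\<close>
  have main: "remaining_rounds ?X Staller C \<le> 2 * j + radius H"
    if "j \<le> ?k" "B (?k - j) \<times> {w} \<subseteq> C" for j C
    using that
  proof (induction j arbitrary: C)
    case 0
    then have "pverts G \<times> {w} \<subseteq> C" using B(3) by auto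
    then show ?case by (simp add: base)
  next
    case (Suc j)
    let ?i = "?k - Suc j"
    have i: "?i < ?k" "Suc ?i = ?k - j" using Suc.prems(1) by auto
    have "remaining_rounds ?X Burner D \<le> Suc (2 * j + radius H)"
      if D: "D \<in> round_outcomes ?X C" for D
    proof -
      \<comment> \<open>\<open>D\<close> contains the first spread of \<open>C\<close> regardless of
        Staller's choice, and Burner's own round supplies the second.\<close>
      have "spread (graph_square G) (B ?i) \<times> {w} \<subseteq> spread ?X D"
        using cartesian_spread_square[OF G(1) w(1) Suc.prems(2)]
          spread_mono[OF spread_subset_round_outcome[OF D], of ?X] by blast
      then obtain E where E: "E \<in> round_outcomes ?X D" "B (Suc ?i) \<times> {w} \<subseteq> E"
        using burner i(1) by blast
      have "remaining_rounds ?X Staller E \<le> 2 * j + radius H"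
        using Suc.IH E(2) Suc.prems(1) i(2) by simp
      then show ?thesis using remaining_rounds_Burner_le[OF fX E(1)] by simp
    qed
    then have "remaining_rounds ?X Staller C \<le> Suc (Suc (2 * j + radius H))"
      by (rule remaining_rounds_Staller_le[OF fX])
    then show ?case by simp
  qed
  \<comment> \<open>With nothing burning there is no spread to wait for, so the first step takes a
    single round: \<open>1 + 2 * (?k - 1)\<close> rounds in all.\<close>
  obtain C where C: "C \<in> round_outcomes ?X {}" "B (Suc 0) \<times> {w} \<subseteq> C"
    using burner[of 0 "{}"] k B(1) by (auto simp: spread_def)
  have "remaining_rounds ?X Staller C \<le> 2 * (?k - 1) + radius H"
    using main[of "?k - 1" C] C(2) k by simp
  then have "remaining_rounds ?X Burner {} \<le> Suc (2 * (?k - 1) + radius H)"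
    using remaining_rounds_Burner_le[OF fX C(1)] by simp
  then show "game_burning_number ?X \<le> 2 * ?k - 1 + radius H"
    using k by (simp add: game_burning_number_def)
qed

theorem proposition17:
  fixes G :: "'a pair_pre_digraph" and H :: "'b pair_pre_digraph"
  assumes "pair_graph G" and "Digraph_Component.connected (with_proj G)"
    and "pair_graph H" and "Digraph_Component.connected (with_proj H)"
  shows "(max (game_burning_number G) (game_burning_number H)
            \<le> game_burning_number (strong_product G H) \<and>
          game_burning_number (strong_product G H)
            \<le> game_burning_number (cartesian_product G H) \<and>
          game_burning_number (cartesian_product G H)
            \<le> min (2 * burning_number (graph_square G) - 1 + radius H)
                  (2 * burning_number (graph_square H) - 1 + radius G)) \<and>
         (max (staller_game_burning_number G) (staller_game_burning_number H)
            \<le> staller_game_burning_number (strong_product G H) \<and>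
          staller_game_burning_number (strong_product G H)
            \<le> staller_game_burning_number (cartesian_product G H) \<and>
          staller_game_burning_number (cartesian_product G H)
            \<le> min (2 * burning_number (graph_square G) + radius H)
                  (2 * burning_number (graph_square H) + radius G))"
proof -
  interpret G: pair_graph G by fact
  interpret H: pair_graph H by fact
  note ne = connected_nonempty[OF assms(2)] connected_nonempty[OF assms(4)]
  have fin: "finite (pverts (strong_product G H))" "finite (pverts (cartesian_product G H))"
    "finite (pverts (cartesian_product H G))"
    by (simp_all add: strong_product_def cartesian_product_def)
  \<comment> \<open>The projection is onto because the other factor is nonempty.\<close>
  have strong_G: "remaining_rounds G p {} \<le> remaining_rounds (strong_product G H) p {}" for p
    using ne by (intro remaining_rounds_weak_hom[OF fin(1), of fst]) (auto simp: strong_product_def)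
  have strong_H: "remaining_rounds H p {} \<le> remaining_rounds (strong_product G H) p {}" for p
    using ne by (intro remaining_rounds_weak_hom[OF fin(1), of snd]) (auto simp: strong_product_def)
  have cart: "remaining_rounds (strong_product G H) p {}
      \<le> remaining_rounds (cartesian_product G H) p {}" for p
    by (intro remaining_rounds_weak_hom[OF fin(2), of id])
      (auto simp: strong_product_def cartesian_product_def)
  \<comment> \<open>Exchanging coordinates makes the bound with the roles of \<open>G\<close> and
    \<open>H\<close> reversed available.\<close>
  have swap: "remaining_rounds (cartesian_product G H) p {}
      \<le> remaining_rounds (cartesian_product H G) p {}" for p
    by (intro remaining_rounds_weak_hom[OF fin(3), of prod.swap])
      (auto simp: cartesian_product_def)
  note GH = game_burning_number_cartesian_le[OF assms]
  note HG = game_burning_number_cartesian_le[OF assms(3,4,1,2)]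
  \<comment> \<open>Positivity keeps the truncated subtraction exact, so that Staller's extra round
    cancels the \<open>- 1\<close>.\<close>
  have pos: "burning_number (graph_square G) > 0" "burning_number (graph_square H) > 0"
    using ne by (auto simp: graph_square_def intro!: burning_number_pos)
  have "game_burning_number (cartesian_product G H)
      \<le> min (2 * burning_number (graph_square G) - 1 + radius H)
            (2 * burning_number (graph_square H) - 1 + radius G)"
    using GH HG swap[of Burner] by (simp add: game_burning_number_def)
  moreover have "staller_game_burning_number (cartesian_product G H)
      \<le> Suc (game_burning_number (cartesian_product G H))"
    using remaining_rounds_Staller_le_Burner[OF fin(2)]
    by (simp add: game_burning_number_def staller_game_burning_number_def)
  ultimately show ?thesis
    using pos strong_G strong_H cart
    by (auto simp: game_burning_number_def staller_game_burning_number_def)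
qed

end
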